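(* Let $r\in A$ and let $k\geq1$. If the dynamical system $f:S_r(0)\to S_r(0)$ has a $k$-periodic orbit $y_0\to y_1\to\dots\to y_{k-1}\to y_0$, then $|(f^k)'(y_i)|_p=1$ for all $i\in\{0,1,\dots,k-1\}$, i.e. the periodic points are indifferent.
   Context: $p$ is a prime, $a,b\in\mathbb{Q}_p$ with $ab\neq0$, and $\sqrt{a^2-4b}$ is assumed to exist in $\mathbb{Q}_p$. $f(x)=\frac{x^3+ax^2+bx}{ax+b}$ is considered on $\mathbb{Q}_p\setminus\{-\frac{b}{a}\}$. Let $x_1,x_2=\frac{-a\pm\sqrt{a^2-4b}}{2}\in\mathbb{Q}_p$, labelled so that $\alpha:=|x_1|_p\leq\beta:=|x_2|_p$, and $\delta=|a|_p$. (One has $\delta\leq\alpha$ if $\alpha=\beta$, and $\delta=\beta$ if $\alpha<\beta$.) Define $A=\{r:0<r<\alpha\}$ if $\delta\leq\alpha=\beta$, and $A=(0,\beta)\setminus\{\alpha\}$ if $\alpha<\beta=\delta$. $S_r(0)=\{x\in\mathbb{Q}_p:|x|_p=r\}$; for $r\in A$ it is invariant under $f$. Here $y\to z$ means $f(y)=z$, and $f^k$ is the $k$-fold iterate. *)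

theory Defs
  imports
    "HOL-Analysis.Analysis"
    "Berlekamp_Zassenhaus.Finite_Field"
begin

section \<open>The \<open>p\<close>-adic absolute value on the rationals\<close>

definition padic_val :: "nat \<Rightarrow> rat \<Rightarrow> int" where
  "padic_val p q =
     int (multiplicity (int p) (fst (quotient_of q))) - int (multiplicity (int p) (snd (quotient_of q)))"

definition padic_abs :: "nat \<Rightarrow> rat \<Rightarrow> real" where
  "padic_abs p q = (if q = 0 then 0 else real p powi (- padic_val p q))"

definition padic_Cauchy :: "nat \<Rightarrow> (nat \<Rightarrow> rat) \<Rightarrow> bool" where
  "padic_Cauchy p X \<longleftrightarrow> (\<forall>e>0. \<exists>k. \<forall>m\<ge>k. \<forall>n\<ge>k. padic_abs p (X m - X n) < e)"

definition padic_null :: "nat \<Rightarrow> (nat \<Rightarrow> rat) \<Rightarrow> bool" where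
  "padic_null p X \<longleftrightarrow> (\<lambda>n. padic_abs p (X n)) \<longlonglongrightarrow> 0"

definition padic_rel :: "nat \<Rightarrow> (nat \<Rightarrow> rat) \<Rightarrow> (nat \<Rightarrow> rat) \<Rightarrow> bool" where
  "padic_rel p X Y \<longleftrightarrow> padic_Cauchy p X \<and> padic_Cauchy p Y \<and> padic_null p (\<lambda>n. X n - Y n)"

lemma padic_abs_0 [simp]: "padic_abs p 0 = 0"
  by (simp add: padic_abs_def)

context
  fixes p :: nat
  assumes p: "prime p"
begin

lemma padic_abs_fraction:
  assumes "m \<noteq> 0" "n \<noteq> 0"
  shows "padic_abs p (of_int m / of_int n) =
    real p powi (int (multiplicity (int p) n) - int (multiplicity (int p) m))"
proof -
  obtain a d where q: "quotient_of (of_int m / of_int n) = (a, d)"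
    by (meson surj_pair)
  have d: "d > 0" using quotient_of_denom_pos[OF q] .
  have eq: "(of_int m / of_int n :: rat) = of_int a / of_int d"
    using quotient_of_div[OF q] .
  have "(of_int (m * d) :: rat) = of_int (a * n)"
    using eq assms d by (simp add: field_simps)
  hence md: "m * d = a * n" by (simp only: of_int_eq_iff)
  have a: "a \<noteq> 0" using md assms d by auto
  have pe: "prime_elem (int p)" using p by auto
  have "multiplicity (int p) m + multiplicity (int p) d = multiplicity (int p) a + multiplicity (int p) n"
    using prime_elem_multiplicity_mult_distrib[OF pe, of m d]
      prime_elem_multiplicity_mult_distrib[OF pe, of a n] md assms d a by simp
  hence "- padic_val p (of_int m / of_int n)
      = int (multiplicity (int p) n) - int (multiplicity (int p) m)"
    by (simp add: padic_val_def q)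
  thus ?thesis using assms by (simp add: padic_abs_def)
qed

lemma rat_as_fraction:
  obtains m n where "(x::rat) = of_int m / of_int n" "n \<noteq> 0"
  by (metis quotient_of_div quotient_of_denom_pos less_irrefl surj_pair)

lemma padic_abs_pos: "x \<noteq> 0 \<Longrightarrow> padic_abs p x > 0"
  using p prime_gt_0_nat by (auto simp: padic_abs_def intro!: zero_less_power_int)

lemma padic_abs_nonneg [simp]: "padic_abs p x \<ge> 0"
  using padic_abs_pos[of x] by (cases "x = 0") auto

lemma padic_abs_eq_0_iff [simp]: "padic_abs p x = 0 \<longleftrightarrow> x = 0"
  using padic_abs_pos[of x] by fastforce

lemma padic_abs_mult: "padic_abs p (x * y) = padic_abs p x * padic_abs p y"
proof (cases "x = 0 \<or> y = 0")
  case False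
  obtain a b where x: "x = of_int a / of_int b" "b \<noteq> 0" by (rule rat_as_fraction)
  obtain c d where y: "y = of_int c / of_int d" "d \<noteq> 0" by (rule rat_as_fraction)
  have ac: "a \<noteq> 0" "c \<noteq> 0" using False x y by auto
  have pe: "prime_elem (int p)" using p by auto
  have p0: "real p \<noteq> 0" using p by auto
  have xy: "x * y = of_int (a * c) / of_int (b * d)" by (simp add: x y)
  show ?thesis unfolding xy unfolding x(1) y(1)
    using ac x y p0
    by (subst (1 2 3) padic_abs_fraction)
      (auto simp: prime_elem_multiplicity_mult_distrib[OF pe] power_int_add[symmetric] algebra_simps)
qed auto

lemma padic_abs_1 [simp]: "padic_abs p 1 = 1"
  using padic_abs_mult[of 1 1] padic_abs_pos[of 1] by simp

lemma padic_abs_inverse: "padic_abs p (inverse x) = inverse (padic_abs p x)"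
proof (cases "x = 0")
  case False
  thus ?thesis using padic_abs_mult[of x "inverse x"]
    by (simp add: field_simps)
qed auto

lemma padic_abs_minus [simp]: "padic_abs p (- x) = padic_abs p x"
proof -
  have "(padic_abs p (-1)) ^ 2 = 1"
    using padic_abs_mult[of "-1" "-1"] by (simp add: power2_eq_square)
  hence "padic_abs p (-1) = 1"
    using padic_abs_nonneg[of "-1"] by (auto simp: power2_eq_1_iff)
  thus ?thesis using padic_abs_mult[of "-1" x] by simp
qed

lemma padic_abs_minus_commute: "padic_abs p (x - y) = padic_abs p (y - x)"
  using padic_abs_minus[of "x - y"] by simp

lemma padic_abs_add_le: "padic_abs p (x + y) \<le> max (padic_abs p x) (padic_abs p y)"
proof (cases "x = 0 \<or> y = 0 \<or> x + y = 0")
  case True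
  thus ?thesis by (auto simp: le_max_iff_disj)
next
  case False
  obtain a b where x: "x = of_int a / of_int b" "b \<noteq> 0" by (rule rat_as_fraction)
  obtain c d where y: "y = of_int c / of_int d" "d \<noteq> 0" by (rule rat_as_fraction)
  define m n e where "m = a * d" and "n = c * b" and "e = b * d"
  have e: "e \<noteq> 0" using x y by (simp add: e_def)
  have x': "x = of_int m / of_int e" and y': "y = of_int n / of_int e"
    using x y by (auto simp: m_def n_def e_def)
  have xy: "x + y = of_int (m + n) / of_int e"
    using x' y' by (simp add: add_divide_distrib)
  have nz: "m \<noteq> 0" "n \<noteq> 0" "m + n \<noteq> 0"
    using False x' y' xy by auto
  let ?M = "multiplicity (int p)"
  have p1: "real p > 1" using p prime_gt_1_nat by auto
  have "?M (m + n) \<ge> min (?M m) (?M n)"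
  proof (rule multiplicity_geI)
    show "int p ^ min (?M m) (?M n) dvd m + n"
      by (intro dvd_add multiplicity_dvd') auto
  qed (use nz p in \<open>auto simp: prime_nat_iff\<close>)
  hence "real p powi (int (?M e) - int (?M (m + n))) \<le>
      max (real p powi (int (?M e) - int (?M m))) (real p powi (int (?M e) - int (?M n)))"
    using p1 by (auto simp: le_max_iff_disj min_def power_int_increasing split: if_splits)
  thus ?thesis unfolding xy unfolding x' y'
    using nz e by (subst (1 2 3) padic_abs_fraction) auto
qed

lemma padic_abs_triangle: "padic_abs p (x + y) \<le> padic_abs p x + padic_abs p y"
  using padic_abs_add_le[of x y] padic_abs_nonneg[of x] padic_abs_nonneg[of y] by linarith

lemma padic_abs_diff_le: "\<bar>padic_abs p x - padic_abs p y\<bar> \<le> padic_abs p (x - y)"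
  using padic_abs_triangle[of "x - y" y] padic_abs_triangle[of "y - x" x]
    padic_abs_minus_commute[of x y] by auto

lemma padic_Cauchy_const: "padic_Cauchy p (\<lambda>n. c)"
  by (simp add: padic_Cauchy_def)

lemma padic_null_0 [simp]: "padic_null p (\<lambda>n. 0)"
  by (simp add: padic_null_def)

lemma padic_null_add:
  assumes "padic_null p X" "padic_null p Y"
  shows "padic_null p (\<lambda>n. X n + Y n)"
  unfolding padic_null_def
proof (rule Lim_null_comparison)
  show "\<forall>\<^sub>F n in sequentially. norm (padic_abs p (X n + Y n)) \<le> padic_abs p (X n) + padic_abs p (Y n)"
    by (simp add: padic_abs_triangle)
  show "(\<lambda>n. padic_abs p (X n) + padic_abs p (Y n)) \<longlonglongrightarrow> 0"
    using tendsto_add[OF assms[unfolded padic_null_def]] by simp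
qed

lemma padic_null_minus: "padic_null p X \<Longrightarrow> padic_null p (\<lambda>n. - X n)"
  by (simp add: padic_null_def)

lemma padic_null_swap: "padic_null p (\<lambda>n. X n - Y n) \<Longrightarrow> padic_null p (\<lambda>n. Y n - X n)"
  by (simp add: padic_null_def padic_abs_minus_commute)

lemma padic_null_mult:
  assumes "padic_null p X" "Bseq (\<lambda>n. padic_abs p (Y n))"
  shows "padic_null p (\<lambda>n. X n * Y n)"
  unfolding padic_null_def padic_abs_mult
  using bounded_bilinear.Zfun_prod_Bfun[OF bounded_bilinear_mult, of "\<lambda>n. padic_abs p (X n)" sequentially "\<lambda>n. padic_abs p (Y n)"] assms
  unfolding padic_null_def by (simp add: tendsto_Zfun_iff)

lemma padic_Cauchy_abs:
  assumes "padic_Cauchy p X"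
  shows "convergent (\<lambda>n. padic_abs p (X n))"
proof (rule real_Cauchy_convergent, rule metric_CauchyI)
  fix e :: real assume "e > 0"
  then obtain k where "\<forall>m\<ge>k. \<forall>n\<ge>k. padic_abs p (X m - X n) < e"
    using assms unfolding padic_Cauchy_def by blast
  thus "\<exists>M. \<forall>m\<ge>M. \<forall>n\<ge>M. dist (padic_abs p (X m)) (padic_abs p (X n)) < e"
    unfolding dist_real_def by (meson le_less_trans padic_abs_diff_le)
qed

lemma padic_Cauchy_Bseq: "padic_Cauchy p X \<Longrightarrow> Bseq (\<lambda>n. padic_abs p (X n))"
  using padic_Cauchy_abs convergent_imp_Bseq by blast

lemma padic_Cauchy_add:
  assumes "padic_Cauchy p X" "padic_Cauchy p Y"
  shows "padic_Cauchy p (\<lambda>n. X n + Y n)"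
  unfolding padic_Cauchy_def
proof (intro allI impI)
  fix e :: real assume e: "e > 0"
  obtain k1 where k1: "\<forall>m\<ge>k1. \<forall>n\<ge>k1. padic_abs p (X m - X n) < e"
    using assms(1) e unfolding padic_Cauchy_def by blast
  obtain k2 where k2: "\<forall>m\<ge>k2. \<forall>n\<ge>k2. padic_abs p (Y m - Y n) < e"
    using assms(2) e unfolding padic_Cauchy_def by blast
  have "padic_abs p (X m + Y m - (X n + Y n)) < e" if "m \<ge> max k1 k2" "n \<ge> max k1 k2" for m n
  proof -
    have "padic_abs p ((X m - X n) + (Y m - Y n)) < e"
      using padic_abs_add_le[of "X m - X n" "Y m - Y n"] k1 k2 that by fastforce
    thus ?thesis by (simp add: algebra_simps)
  qed
  thus "\<exists>k. \<forall>m\<ge>k. \<forall>n\<ge>k. padic_abs p (X m + Y m - (X n + Y n)) < e" by blast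
qed

lemma padic_Cauchy_minus: "padic_Cauchy p X \<Longrightarrow> padic_Cauchy p (\<lambda>n. - X n)"
  unfolding padic_Cauchy_def
  by (metis minus_diff_minus padic_abs_minus)

lemma padic_Cauchy_mult:
  assumes X: "padic_Cauchy p X" and Y: "padic_Cauchy p Y"
  shows "padic_Cauchy p (\<lambda>n. X n * Y n)"
  unfolding padic_Cauchy_def
proof (intro allI impI)
  fix e :: real assume e: "e > 0"
  obtain A where A: "A > 0" "\<And>n. padic_abs p (X n) \<le> A"
    using padic_Cauchy_Bseq[OF X] by (auto simp: Bseq_def)
  obtain B where B: "B > 0" "\<And>n. padic_abs p (Y n) \<le> B"
    using padic_Cauchy_Bseq[OF Y] by (auto simp: Bseq_def)
  obtain k1 where k1: "\<forall>m\<ge>k1. \<forall>n\<ge>k1. padic_abs p (X m - X n) < e / B"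
    using X e B(1) unfolding padic_Cauchy_def by (meson divide_pos_pos)
  obtain k2 where k2: "\<forall>m\<ge>k2. \<forall>n\<ge>k2. padic_abs p (Y m - Y n) < e / A"
    using Y e A(1) unfolding padic_Cauchy_def by (meson divide_pos_pos)
  have "padic_abs p (X m * Y m - X n * Y n) < e" if "m \<ge> max k1 k2" "n \<ge> max k1 k2" for m n
  proof -
    have "padic_abs p ((X m - X n) * Y m) \<le> padic_abs p (X m - X n) * B"
      unfolding padic_abs_mult using B by (intro mult_left_mono) auto
    moreover have "padic_abs p (X m - X n) * B < e / B * B"
      using k1 that B by (intro mult_strict_right_mono) auto
    moreover have "padic_abs p (X n * (Y m - Y n)) \<le> A * padic_abs p (Y m - Y n)"
      unfolding padic_abs_mult using A by (intro mult_right_mono) auto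
    moreover have "A * padic_abs p (Y m - Y n) < A * (e / A)"
      using k2 that A by (intro mult_strict_left_mono) auto
    ultimately have "padic_abs p ((X m - X n) * Y m + X n * (Y m - Y n)) < e"
      using padic_abs_add_le[of "(X m - X n) * Y m" "X n * (Y m - Y n)"] A B by simp
    thus ?thesis by (simp add: algebra_simps)
  qed
  thus "\<exists>k. \<forall>m\<ge>k. \<forall>n\<ge>k. padic_abs p (X m * Y m - X n * Y n) < e" by blast
qed

lemma padic_Cauchy_not_null:
  assumes X: "padic_Cauchy p X" and nn: "\<not> padic_null p X"
  obtains c k where "c > 0" "\<And>n. n \<ge> k \<Longrightarrow> padic_abs p (X n) > c"
proof -
  obtain L where L: "(\<lambda>n. padic_abs p (X n)) \<longlonglongrightarrow> L"
    using padic_Cauchy_abs[OF X] by (auto simp: convergent_def)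
  have "L \<noteq> 0" using L nn by (auto simp: padic_null_def)
  moreover have "L \<ge> 0" using L by (rule LIMSEQ_le_const) auto
  ultimately have "L / 2 < L" "L / 2 > 0" by auto
  moreover obtain k where "\<forall>n\<ge>k. padic_abs p (X n) > L / 2"
    using order_tendstoD(1)[OF L, of "L / 2"] calculation by (auto simp: eventually_sequentially)
  ultimately show thesis using that by blast
qed

lemma padic_null_inverse_diff:
  assumes X: "padic_Cauchy p X" "\<not> padic_null p X" and Y: "padic_Cauchy p Y" "\<not> padic_null p Y"
    and XY: "\<forall>e>0. \<exists>k. \<forall>m\<ge>k. \<forall>n\<ge>k. padic_abs p (X m - Y n) < e"
  shows "\<forall>e>0. \<exists>k. \<forall>m\<ge>k. \<forall>n\<ge>k. padic_abs p (inverse (X m) - inverse (Y n)) < e"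
proof (intro allI impI)
  fix e :: real assume e: "e > 0"
  obtain c i where c: "c > 0" "\<And>n. n \<ge> i \<Longrightarrow> padic_abs p (X n) > c"
    using padic_Cauchy_not_null[OF X] by blast
  obtain d j where d: "d > 0" "\<And>n. n \<ge> j \<Longrightarrow> padic_abs p (Y n) > d"
    using padic_Cauchy_not_null[OF Y] by blast
  obtain k where k: "\<forall>m\<ge>k. \<forall>n\<ge>k. padic_abs p (X m - Y n) < e * (c * d)"
    using XY e c(1) d(1) by (meson mult_pos_pos)
  have "padic_abs p (inverse (X m) - inverse (Y n)) < e"
    if "m \<ge> max i (max j k)" "n \<ge> max i (max j k)" for m n
  proof -
    have cd: "padic_abs p (X m) > c" "padic_abs p (Y n) > d" using c d that by auto
    hence nz: "X m \<noteq> 0" "Y n \<noteq> 0" using c(1) d(1) by auto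
    have eq: "inverse (X m) - inverse (Y n) = (Y n - X m) * inverse (X m * Y n)"
      using nz by (simp add: field_simps)
    have pos: "padic_abs p (X m) * padic_abs p (Y n) > 0" using nz padic_abs_pos by simp
    have "padic_abs p (Y n - X m) < e * (c * d)"
      using k that by (simp add: padic_abs_minus_commute)
    also have "\<dots> < e * (padic_abs p (X m) * padic_abs p (Y n))"
      using cd c(1) d(1) e by (intro mult_strict_left_mono mult_strict_mono) auto
    finally show ?thesis unfolding eq padic_abs_mult padic_abs_inverse using pos
      by (simp add: field_simps)
  qed
  thus "\<exists>k. \<forall>m\<ge>k. \<forall>n\<ge>k. padic_abs p (inverse (X m) - inverse (Y n)) < e" by blast
qed

lemma padic_Cauchy_inverse:
  assumes "padic_Cauchy p X" "\<not> padic_null p X"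
  shows "padic_Cauchy p (\<lambda>n. inverse (X n))"
  unfolding padic_Cauchy_def
  using padic_null_inverse_diff[OF assms assms] assms(1)[unfolded padic_Cauchy_def] by blast

lemma padic_rel_uniform:
  assumes "padic_rel p X Y"
  shows "\<forall>e>0. \<exists>k. \<forall>m\<ge>k. \<forall>n\<ge>k. padic_abs p (X m - Y n) < e"
proof (intro allI impI)
  fix e :: real assume e: "e > 0"
  obtain k1 where k1: "\<forall>m\<ge>k1. \<forall>n\<ge>k1. padic_abs p (X m - X n) < e"
    using assms e unfolding padic_rel_def padic_Cauchy_def by blast
  have "(\<lambda>n. padic_abs p (X n - Y n)) \<longlonglongrightarrow> 0"
    using assms by (simp add: padic_rel_def padic_null_def)
  from order_tendstoD(2)[OF this e] obtain k2 where k2: "\<forall>n\<ge>k2. padic_abs p (X n - Y n) < e"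
    by (auto simp: eventually_sequentially)
  have "padic_abs p (X m - Y n) < e" if "m \<ge> max k1 k2" "n \<ge> max k1 k2" for m n
    using padic_abs_add_le[of "X m - X n" "X n - Y n"] k1 k2 that by fastforce
  thus "\<exists>k. \<forall>m\<ge>k. \<forall>n\<ge>k. padic_abs p (X m - Y n) < e" by blast
qed

lemma padic_rel_refl: "padic_Cauchy p X \<Longrightarrow> padic_rel p X X"
  by (simp add: padic_rel_def)

lemma part_equivp_padic_rel: "part_equivp (padic_rel p)"
proof (rule part_equivpI)
  show "\<exists>x. padic_rel p x x" using padic_rel_refl padic_Cauchy_const by blast
  show "symp (padic_rel p)"
    by (auto simp: symp_def padic_rel_def intro: padic_null_swap)
  show "transp (padic_rel p)"
  proof (rule transpI)
    fix X Y Z assume "padic_rel p X Y" "padic_rel p Y Z"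
    thus "padic_rel p X Z"
      using padic_null_add[of "\<lambda>n. X n - Y n" "\<lambda>n. Y n - Z n"] by (simp add: padic_rel_def)
  qed
qed

lemma padic_rel_null_iff: "padic_rel p X Y \<Longrightarrow> padic_null p X \<longleftrightarrow> padic_null p Y"
  using padic_null_add[of "\<lambda>n. X n - Y n" Y] padic_null_add[of "\<lambda>n. Y n - X n" X]
    padic_null_swap[of X Y]
  by (auto simp: padic_rel_def)

lemma padic_rel_add:
  "padic_rel p X Y \<Longrightarrow> padic_rel p X' Y' \<Longrightarrow> padic_rel p (\<lambda>n. X n + X' n) (\<lambda>n. Y n + Y' n)"
  using padic_null_add[of "\<lambda>n. X n - Y n" "\<lambda>n. X' n - Y' n"]
  by (simp add: padic_rel_def padic_Cauchy_add algebra_simps)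

lemma padic_rel_minus: "padic_rel p X Y \<Longrightarrow> padic_rel p (\<lambda>n. - X n) (\<lambda>n. - Y n)"
  using padic_null_minus[of "\<lambda>n. X n - Y n"]
  by (simp add: padic_rel_def padic_Cauchy_minus algebra_simps)

lemma padic_rel_mult:
  assumes "padic_rel p X Y" "padic_rel p X' Y'"
  shows "padic_rel p (\<lambda>n. X n * X' n) (\<lambda>n. Y n * Y' n)"
proof -
  have "padic_null p (\<lambda>n. (X n - Y n) * X' n + (X' n - Y' n) * Y n)"
    using assms by (intro padic_null_add padic_null_mult padic_Cauchy_Bseq) (auto simp: padic_rel_def)
  also have "(\<lambda>n. (X n - Y n) * X' n + (X' n - Y' n) * Y n) = (\<lambda>n. X n * X' n - Y n * Y' n)"
    by (simp add: algebra_simps)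
  finally show ?thesis using assms by (simp add: padic_rel_def padic_Cauchy_mult)
qed

lemma padic_rel_inverse:
  assumes "padic_rel p X Y" "\<not> padic_null p X"
  shows "padic_rel p (\<lambda>n. inverse (X n)) (\<lambda>n. inverse (Y n))"
proof -
  have C: "padic_Cauchy p X" "padic_Cauchy p Y" using assms by (auto simp: padic_rel_def)
  have nn: "\<not> padic_null p Y" using assms padic_rel_null_iff by blast
  have u: "\<forall>e>0. \<exists>k. \<forall>m\<ge>k. \<forall>n\<ge>k. padic_abs p (inverse (X m) - inverse (Y n)) < e"
    using padic_null_inverse_diff[OF C(1) assms(2) C(2) nn padic_rel_uniform[OF assms(1)]] .
  have "padic_null p (\<lambda>n. inverse (X n) - inverse (Y n))"
    unfolding padic_null_def lim_sequentially using u
    by (metis (no_types, lifting) diff_zero dist_real_def abs_of_nonneg padic_abs_nonneg)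
  thus ?thesis using C nn assms by (simp add: padic_rel_def padic_Cauchy_inverse)
qed

lemma padic_rel_lim:
  assumes "padic_rel p X Y"
  shows "lim (\<lambda>n. padic_abs p (X n)) = lim (\<lambda>n. padic_abs p (Y n))"
proof -
  have "(\<lambda>n. padic_abs p (X n)) \<longlonglongrightarrow> lim (\<lambda>n. padic_abs p (X n))"
    using assms padic_Cauchy_abs convergent_LIMSEQ_iff unfolding padic_rel_def by blast
  moreover have "(\<lambda>n. padic_abs p (Y n) - padic_abs p (X n)) \<longlonglongrightarrow> 0"
  proof (rule Lim_null_comparison)
    show "\<forall>\<^sub>F n in sequentially. norm (padic_abs p (Y n) - padic_abs p (X n)) \<le> padic_abs p (X n - Y n)"
      by (simp add: padic_abs_diff_le padic_abs_minus_commute[of "X _"])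
    show "(\<lambda>n. padic_abs p (X n - Y n)) \<longlonglongrightarrow> 0"
      using assms by (simp add: padic_rel_def padic_null_def)
  qed
  ultimately have "(\<lambda>n. padic_abs p (X n) + (padic_abs p (Y n) - padic_abs p (X n)))
      \<longlonglongrightarrow> lim (\<lambda>n. padic_abs p (X n)) + 0" by (rule tendsto_add)
  thus ?thesis by (simp add: limI)
qed

end


section \<open>The field \<open>\<rat>\<^sub>p\<close> as the completion of the rationals\<close>

text \<open>
  The prime is \<open>p = CARD('p)\<close>, the cardinality of the index type; the class
  \<^class>\<open>prime_card\<close> says precisely that this cardinality is prime.
  The elements are the classes of \<open>p\<close>-adic Cauchy sequences modulo null sequences.
\<close>

typedef 'p padic =
  "{C. \<exists>X. padic_Cauchy CARD('p::prime_card) X \<and> C = {Y. padic_rel CARD('p) X Y}}"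
  morphisms padic_class Abs_padic
  using padic_Cauchy_const[OF prime_card] by blast

definition padic_of :: "(nat \<Rightarrow> rat) \<Rightarrow> 'p::prime_card padic" where
  "padic_of X = Abs_padic {Y. padic_rel CARD('p) X Y}"

definition padic_rep :: "'p::prime_card padic \<Rightarrow> nat \<Rightarrow> rat" where
  "padic_rep x = (SOME X. X \<in> padic_class x)"

lemma padic_of_eq_iff:
  assumes "padic_Cauchy CARD('p) X" "padic_Cauchy CARD('p) Y"
  shows "(padic_of X :: 'p::prime_card padic) = padic_of Y \<longleftrightarrow> padic_rel CARD('p) X Y"
proof -
  have "(padic_of X :: 'p padic) = padic_of Y \<longleftrightarrow>
      {Z. padic_rel CARD('p) X Z} = {Z. padic_rel CARD('p) Y Z}"
    unfolding padic_of_def using assms by (subst Abs_padic_inject) auto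
  also have "\<dots> \<longleftrightarrow> padic_rel CARD('p) X Y"
    using part_equivp_padic_rel[OF prime_card[where 'a='p]] padic_rel_refl[OF prime_card assms(2)]
    by (auto dest: part_equivp_symp part_equivp_transp)
  finally show ?thesis .
qed

lemma padic_class_of:
  "padic_Cauchy CARD('p) X \<Longrightarrow> padic_class (padic_of X :: 'p::prime_card padic) = {Y. padic_rel CARD('p) X Y}"
  unfolding padic_of_def by (subst Abs_padic_inverse) auto

lemma padic_cases [cases type: padic]:
  fixes x :: "'p::prime_card padic"
  obtains X where "padic_Cauchy CARD('p) X" "x = padic_of X"
  by (cases x) (auto simp: padic_of_def)

lemma padic_rep_of:
  assumes "padic_Cauchy CARD('p) X"
  shows "padic_rel CARD('p) X (padic_rep (padic_of X :: 'p::prime_card padic))"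
  unfolding padic_rep_def padic_class_of[OF assms]
  using padic_rel_refl[OF prime_card assms] by (metis (mono_tags) mem_Collect_eq someI)

instantiation padic :: (prime_card) field
begin

definition "0 = (padic_of (\<lambda>n. 0) :: 'a padic)"

definition "1 = (padic_of (\<lambda>n. 1) :: 'a padic)"

definition "x + y = padic_of (\<lambda>n. padic_rep x n + padic_rep y n)" for x y :: "'a padic"

definition "- x = padic_of (\<lambda>n. - padic_rep x n)" for x :: "'a padic"

definition "x - y = x + - y" for x y :: "'a padic"

definition "x * y = padic_of (\<lambda>n. padic_rep x n * padic_rep y n)" for x y :: "'a padic"

definition "inverse x = (if x = 0 then 0 else padic_of (\<lambda>n. inverse (padic_rep x n)))" for x :: "'a padic"

definition "x div y = x * inverse y" for x y :: "'a padic"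

lemma padic_of_eqI: "padic_rel CARD('a) X Y \<Longrightarrow> (padic_of X :: 'a padic) = padic_of Y"
  using padic_of_eq_iff[where 'p='a] by (auto simp: padic_rel_def)

lemma padic_of_add:
  assumes "padic_Cauchy CARD('a) X" "padic_Cauchy CARD('a) Y"
  shows "(padic_of X :: 'a padic) + padic_of Y = padic_of (\<lambda>n. X n + Y n)"
  unfolding plus_padic_def
  by (rule padic_of_eqI[symmetric], intro padic_rel_add[OF prime_card] padic_rep_of assms)

lemma padic_of_minus:
  assumes "padic_Cauchy CARD('a) X"
  shows "- (padic_of X :: 'a padic) = padic_of (\<lambda>n. - X n)"
  unfolding uminus_padic_def
  by (rule padic_of_eqI[symmetric], intro padic_rel_minus[OF prime_card] padic_rep_of assms)

lemma padic_of_mult: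
  assumes "padic_Cauchy CARD('a) X" "padic_Cauchy CARD('a) Y"
  shows "(padic_of X :: 'a padic) * padic_of Y = padic_of (\<lambda>n. X n * Y n)"
  unfolding times_padic_def
  by (rule padic_of_eqI[symmetric], intro padic_rel_mult[OF prime_card] padic_rep_of assms)

lemma padic_of_eq_0_iff:
  assumes "padic_Cauchy CARD('a) X"
  shows "(padic_of X :: 'a padic) = 0 \<longleftrightarrow> padic_null CARD('a) X"
  unfolding zero_padic_def using assms
  by (subst padic_of_eq_iff) (auto simp: padic_rel_def padic_Cauchy_const[OF prime_card])

lemma padic_of_inverse:
  assumes "padic_Cauchy CARD('a) X" "\<not> padic_null CARD('a) X"
  shows "inverse (padic_of X :: 'a padic) = padic_of (\<lambda>n. inverse (X n))"
proof -
  have "(padic_of X :: 'a padic) \<noteq> 0" using padic_of_eq_0_iff assms by blast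
  hence "inverse (padic_of X :: 'a padic) = padic_of (\<lambda>n. inverse (padic_rep (padic_of X :: 'a padic) n))"
    by (simp add: inverse_padic_def)
  also have "\<dots> = padic_of (\<lambda>n. inverse (X n))"
    by (rule padic_of_eqI[symmetric], intro padic_rel_inverse[OF prime_card] padic_rep_of assms)
  finally show ?thesis .
qed

lemmas padic_Cauchy_intros =
  padic_Cauchy_const[OF prime_card] padic_Cauchy_add[OF prime_card]
  padic_Cauchy_minus[OF prime_card] padic_Cauchy_mult[OF prime_card]

instance
proof
  fix a b c :: "'a padic"
  obtain A B C where A: "padic_Cauchy CARD('a) A" "a = padic_of A"
    and B: "padic_Cauchy CARD('a) B" "b = padic_of B"
    and C: "padic_Cauchy CARD('a) C" "c = padic_of C"
    by (metis padic_cases)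
  note defs = A(2) B(2) C(2) zero_padic_def one_padic_def
  note ABC = A(1) B(1) C(1)
  show "a + b + c = a + (b + c)"
    unfolding defs using ABC by (simp add: padic_of_add padic_Cauchy_intros add.assoc)
  show "a + b = b + a"
    unfolding defs using ABC by (simp add: padic_of_add add.commute)
  show "0 + a = a"
    unfolding defs using ABC by (simp add: padic_of_add padic_Cauchy_intros)
  show "- a + a = 0"
    unfolding defs using ABC by (simp add: padic_of_add padic_of_minus padic_Cauchy_intros)
  show "a - b = a + - b"
    by (rule minus_padic_def)
  show "a * b * c = a * (b * c)"
    unfolding defs using ABC by (simp add: padic_of_mult padic_Cauchy_intros mult.assoc)
  show "a * b = b * a"
    unfolding defs using ABC by (simp add: padic_of_mult mult.commute)
  show "1 * a = a"
    unfolding defs using ABC by (simp add: padic_of_mult padic_Cauchy_intros)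
  show "(a + b) * c = a * c + b * c"
    unfolding defs using ABC
    by (simp add: padic_of_mult padic_of_add padic_Cauchy_intros distrib_right)
  have "\<not> padic_null CARD('a) (\<lambda>n. 1)"
    by (simp add: padic_null_def padic_abs_1[OF prime_card] LIMSEQ_const_iff)
  hence "(1 :: 'a padic) \<noteq> 0"
    unfolding one_padic_def using padic_of_eq_0_iff padic_Cauchy_intros(1) by blast
  thus "(0 :: 'a padic) \<noteq> 1" by simp
  show "a div b = a * inverse b"
    by (rule divide_padic_def)
  show "inverse 0 = (0 :: 'a padic)"
    by (simp add: inverse_padic_def)
  show "inverse a * a = 1" if "a \<noteq> 0"
  proof -
    have nn: "\<not> padic_null CARD('a) A" using that padic_of_eq_0_iff A by blast
    obtain e k where "e > 0" "\<And>n. n \<ge> k \<Longrightarrow> padic_abs CARD('a) (A n) > e"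
      using padic_Cauchy_not_null[OF prime_card A(1) nn] by blast
    hence "A n \<noteq> 0" if "n \<ge> k" for n
      using that by (metis less_asym padic_abs_0)
    hence "\<forall>\<^sub>F n in sequentially. padic_abs CARD('a) (inverse (A n) * A n - 1) = 0"
      unfolding eventually_sequentially by (intro exI[of _ k]) simp
    hence "padic_null CARD('a) (\<lambda>n. inverse (A n) * A n - 1)"
      unfolding padic_null_def by (rule tendsto_eventually)
    hence "padic_rel CARD('a) (\<lambda>n. inverse (A n) * A n) (\<lambda>n. 1)"
      using A nn by (simp add: padic_rel_def padic_Cauchy_intros padic_Cauchy_inverse[OF prime_card])
    thus ?thesis
      unfolding defs using A nn
      by (simp add: padic_of_inverse padic_of_mult padic_Cauchy_inverse[OF prime_card] padic_of_eqI)
  qed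
qed

end

definition padic_norm :: "'p::prime_card padic \<Rightarrow> real" where
  "padic_norm x = lim (\<lambda>n. padic_abs CARD('p) (padic_rep x n))"

lemma padic_of_norm_lim:
  assumes "padic_Cauchy CARD('p) X"
  shows "(\<lambda>n. padic_abs CARD('p) (X n)) \<longlonglongrightarrow> padic_norm (padic_of X :: 'p::prime_card padic)"
  using padic_rel_lim[OF prime_card padic_rep_of[OF assms]]
    padic_Cauchy_abs[OF prime_card assms, unfolded convergent_LIMSEQ_iff]
  by (simp add: padic_norm_def)

lemma padic_norm_eq_0_iff [simp]: "padic_norm (x :: 'p::prime_card padic) = 0 \<longleftrightarrow> x = 0"
proof -
  obtain X where X: "padic_Cauchy CARD('p) X" "x = padic_of X" by (rule padic_cases)
  show ?thesis using padic_of_norm_lim[OF X(1)] padic_of_eq_0_iff[OF X(1)] X(2)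
    by (auto simp: padic_null_def LIMSEQ_unique)
qed

lemma padic_norm_nonneg [simp]: "padic_norm (x :: 'p::prime_card padic) \<ge> 0"
proof -
  obtain X where X: "padic_Cauchy CARD('p) X" "x = padic_of X" by (rule padic_cases)
  show ?thesis using padic_of_norm_lim[OF X(1)] X(2)
    by (auto intro: LIMSEQ_le_const padic_abs_nonneg[OF prime_card])
qed

lemma padic_norm_mult: "padic_norm (x * y) = padic_norm x * padic_norm (y :: 'p::prime_card padic)"
proof -
  obtain X where X: "padic_Cauchy CARD('p) X" "x = padic_of X" by (rule padic_cases)
  obtain Y where Y: "padic_Cauchy CARD('p) Y" "y = padic_of Y" by (rule padic_cases)
  have "(\<lambda>n. padic_abs CARD('p) (X n * Y n)) \<longlonglongrightarrow> padic_norm x * padic_norm y"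
    unfolding padic_abs_mult[OF prime_card] using X Y by (auto intro!: tendsto_mult padic_of_norm_lim)
  moreover have "(\<lambda>n. padic_abs CARD('p) (X n * Y n)) \<longlonglongrightarrow> padic_norm (x * y)"
    unfolding X(2) Y(2) padic_of_mult[OF X(1) Y(1)]
    by (intro padic_of_norm_lim padic_Cauchy_intros X Y)
  ultimately show ?thesis by (rule LIMSEQ_unique[symmetric])
qed

lemma padic_norm_minus [simp]: "padic_norm (- x :: 'p::prime_card padic) = padic_norm x"
proof -
  obtain X where X: "padic_Cauchy CARD('p) X" "x = padic_of X" by (rule padic_cases)
  show ?thesis
    using padic_of_norm_lim[OF padic_Cauchy_intros(3)[OF X(1)]] padic_of_norm_lim[OF X(1)]
    by (simp add: X(2) padic_of_minus[OF X(1)] padic_abs_minus[OF prime_card] LIMSEQ_unique)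
qed

lemma padic_norm_add_le: "padic_norm (x + y) \<le> max (padic_norm x) (padic_norm (y :: 'p::prime_card padic))"
proof -
  obtain X where X: "padic_Cauchy CARD('p) X" "x = padic_of X" by (rule padic_cases)
  obtain Y where Y: "padic_Cauchy CARD('p) Y" "y = padic_of Y" by (rule padic_cases)
  have "(\<lambda>n. padic_abs CARD('p) (X n + Y n)) \<longlonglongrightarrow> padic_norm (x + y)"
    unfolding X(2) Y(2) padic_of_add[OF X(1) Y(1)]
    by (intro padic_of_norm_lim padic_Cauchy_intros X Y)
  moreover have "(\<lambda>n. max (padic_abs CARD('p) (X n)) (padic_abs CARD('p) (Y n))) \<longlonglongrightarrow> max (padic_norm x) (padic_norm y)"
    using X Y by (auto intro!: tendsto_max padic_of_norm_lim)
  ultimately show ?thesis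
    by (rule LIMSEQ_le) (use padic_abs_add_le[OF prime_card] in blast)
qed

instantiation padic :: (prime_card) metric_space
begin

definition "dist x y = padic_norm (x - y)" for x y :: "'a padic"

definition "(uniformity :: ('a padic \<times> 'a padic) filter) =
  (INF e\<in>{0<..}. principal {(x, y). dist x y < e})"

definition "open U \<longleftrightarrow> (\<forall>x\<in>U. \<forall>\<^sub>F (x', y) in uniformity. x' = x \<longrightarrow> y \<in> U)"
  for U :: "'a padic set"

instance
proof
  fix x y z :: "'a padic"
  show "dist x y = 0 \<longleftrightarrow> x = y" by (simp add: dist_padic_def)
  have "padic_norm (x - y) \<le> max (padic_norm (x - z)) (padic_norm (z - y))"
    using padic_norm_add_le[of "x - z" "z - y"] by simp
  also have "padic_norm (z - y) = padic_norm (y - z)"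
    using padic_norm_minus[of "y - z"] by simp
  finally show "dist x y \<le> dist x z + dist y z"
    using padic_norm_nonneg[of "x - z"] padic_norm_nonneg[of "y - z"]
    unfolding dist_padic_def by linarith
qed (rule uniformity_padic_def open_padic_def)+

end

lemma padic_of_nat: "(of_nat m :: 'p::prime_card padic) = padic_of (\<lambda>n. of_nat m)"
  by (induction m)
    (simp_all add: zero_padic_def one_padic_def padic_of_add padic_Cauchy_intros)

instance padic :: (prime_card) field_char_0
proof
  show "inj (of_nat :: nat \<Rightarrow> 'a padic)"
  proof
    fix m n assume "(of_nat m :: 'a padic) = of_nat n"
    hence "padic_null CARD('a) (\<lambda>i. of_nat m - of_nat n)"
      unfolding padic_of_nat
      by (subst (asm) padic_of_eq_iff) (auto simp: padic_rel_def padic_Cauchy_intros)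
    thus "m = n"
      by (simp add: padic_null_def LIMSEQ_const_iff padic_abs_eq_0_iff[OF prime_card])
  qed
qed

lemma padic_of_rat: "(of_rat q :: 'p::prime_card padic) = padic_of (\<lambda>n. q)"
proof -
  have int: "(of_int k :: 'p padic) = padic_of (\<lambda>n. of_int k)" for k
    by (cases k) (simp_all add: padic_of_nat padic_of_minus padic_Cauchy_intros
      one_padic_def padic_of_add flip: of_nat_Suc)
  obtain a b where q: "q = of_int a / of_int b" "b \<noteq> 0"
    by (rule rat_as_fraction[OF prime_card[where 'a='p]])
  have "(of_rat q :: 'p padic) * of_int b = of_int a"
    using q by (simp add: of_rat_divide)
  moreover have "(padic_of (\<lambda>n. q) :: 'p padic) * of_int b = of_int a"
    unfolding int using q by (simp add: padic_of_mult padic_Cauchy_intros)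
  ultimately show ?thesis using q(2)
    by (metis mult_right_cancel of_int_eq_0_iff)
qed

lemma padic_norm_of_rat: "padic_norm (of_rat q :: 'p::prime_card padic) = padic_abs CARD('p) q"
  using padic_of_norm_lim[OF padic_Cauchy_const[OF prime_card[where 'a='p], of q]]
  by (simp add: padic_of_rat LIMSEQ_const_iff)

lemma padic_rat_dense:
  fixes x :: "'p::prime_card padic"
  assumes "e > 0"
  shows "\<exists>q. dist x (of_rat q) < e"
proof -
  obtain X where X: "padic_Cauchy CARD('p) X" "x = padic_of X" by (rule padic_cases)
  obtain k where k: "\<forall>m\<ge>k. \<forall>n\<ge>k. padic_abs CARD('p) (X m - X n) < e / 2"
    using X(1) assms unfolding padic_Cauchy_def by (meson half_gt_zero)
  have C: "padic_Cauchy CARD('p) (\<lambda>n. X n + - X k)"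
    by (intro padic_Cauchy_intros X)
  have "x - of_rat (X k) = padic_of (\<lambda>n. X n + - X k)"
    using X by (simp add: padic_of_rat diff_conv_add_uminus padic_of_minus padic_of_add
      padic_Cauchy_intros del: add_uminus_conv_diff)
  hence "(\<lambda>n. padic_abs CARD('p) (X n - X k)) \<longlonglongrightarrow> dist x (of_rat (X k))"
    using padic_of_norm_lim[OF C] by (simp add: dist_padic_def)
  hence "dist x (of_rat (X k)) \<le> e / 2"
    by (rule LIMSEQ_le_const2) (use k in \<open>auto intro!: exI[of _ k] less_imp_le\<close>)
  thus ?thesis using assms by (intro exI[of _ "X k"]) simp
qed

lemma padic_of_tendsto:
  assumes X: "padic_Cauchy CARD('p) X"
  shows "(\<lambda>n. of_rat (X n)) \<longlonglongrightarrow> (padic_of X :: 'p::prime_card padic)"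
proof (rule metric_LIMSEQ_I)
  fix e :: real assume e: "e > 0"
  obtain k where k: "\<forall>m\<ge>k. \<forall>n\<ge>k. padic_abs CARD('p) (X m - X n) < e / 2"
    using X e unfolding padic_Cauchy_def by (meson half_gt_zero)
  have "dist (of_rat (X m)) (padic_of X :: 'p padic) < e" if m: "m \<ge> k" for m
  proof -
    have C: "padic_Cauchy CARD('p) (\<lambda>n. X m + - X n)"
      by (intro padic_Cauchy_intros X)
    have "(of_rat (X m) :: 'p padic) - padic_of X = padic_of (\<lambda>n. X m + - X n)"
      using X by (simp add: padic_of_rat diff_conv_add_uminus padic_of_minus padic_of_add
        padic_Cauchy_intros del: add_uminus_conv_diff)
    hence "(\<lambda>n. padic_abs CARD('p) (X m - X n)) \<longlonglongrightarrow> dist (of_rat (X m)) (padic_of X :: 'p padic)"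
      using padic_of_norm_lim[OF C] by (simp add: dist_padic_def)
    hence "dist (of_rat (X m)) (padic_of X :: 'p padic) \<le> e / 2"
      by (rule LIMSEQ_le_const2) (use k m in \<open>auto intro!: exI[of _ k] less_imp_le\<close>)
    thus ?thesis using e by simp
  qed
  thus "\<exists>k. \<forall>m\<ge>k. dist (of_rat (X m)) (padic_of X :: 'p padic) < e" by blast
qed

instance padic :: (prime_card) complete_space
proof
  fix X :: "nat \<Rightarrow> 'a padic"
  assume X: "Cauchy X"
  have "\<exists>q. dist (X n) (of_rat q) < inverse (of_nat (Suc n))" for n
    by (rule padic_rat_dense) simp
  then obtain Q where Q: "\<And>n. dist (X n) (of_rat (Q n)) < inverse (of_nat (Suc n))"
    by metis
  have XQ: "(\<lambda>n. dist (X n) (of_rat (Q n))) \<longlonglongrightarrow> 0"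
    by (rule tendsto_sandwich[OF _ _ tendsto_const LIMSEQ_inverse_real_of_nat])
      (use Q in \<open>auto intro!: always_eventually less_imp_le simp del: of_nat_Suc\<close>)
  define L :: "'a padic" where "L = padic_of Q"
  have "padic_Cauchy CARD('a) Q"
    unfolding padic_Cauchy_def
  proof (intro allI impI)
    fix e :: real assume e: "e > 0"
    obtain k1 where k1: "\<forall>m\<ge>k1. \<forall>n\<ge>k1. dist (X m) (X n) < e / 3"
      using X e unfolding Cauchy_def by (meson divide_pos_pos zero_less_numeral)
    obtain k2 where k2: "\<forall>n\<ge>k2. dist (X n) (of_rat (Q n)) < e / 3"
      using order_tendstoD(2)[OF XQ, of "e / 3"] e by (auto simp: eventually_sequentially)
    have "padic_abs CARD('a) (Q m - Q n) < e" if mn: "m \<ge> max k1 k2" "n \<ge> max k1 k2" for m n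
    proof -
      have "dist (of_rat (Q m) :: 'a padic) (of_rat (Q n))
          \<le> dist (X m) (of_rat (Q m)) + (dist (X m) (X n) + dist (X n) (of_rat (Q n)))"
        by (metis add_left_mono dist_triangle dist_triangle3 order_trans)
      also have "\<dots> < e / 3 + (e / 3 + e / 3)"
        using k1 k2 mn by (intro add_strict_mono) auto
      finally show ?thesis
        by (simp add: dist_padic_def padic_norm_of_rat flip: of_rat_diff)
    qed
    thus "\<exists>k. \<forall>m\<ge>k. \<forall>n\<ge>k. padic_abs CARD('a) (Q m - Q n) < e" by blast
  qed
  hence "(\<lambda>n. of_rat (Q n)) \<longlonglongrightarrow> L"
    unfolding L_def by (rule padic_of_tendsto)
  hence Q0: "(\<lambda>n. dist (of_rat (Q n)) L) \<longlonglongrightarrow> 0"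
    by (rule iffD1[OF tendsto_dist_iff])
  have "(\<lambda>n. dist (X n) L) \<longlonglongrightarrow> 0"
  proof (rule tendsto_sandwich[OF _ _ tendsto_const])
    show "(\<lambda>n. dist (X n) (of_rat (Q n)) + dist (of_rat (Q n)) L) \<longlonglongrightarrow> 0"
      using tendsto_add[OF XQ Q0] by simp
    show "\<forall>\<^sub>F n in sequentially. dist (X n) L \<le>
        dist (X n) (of_rat (Q n)) + dist (of_rat (Q n)) L"
      by (intro always_eventually allI dist_triangle)
  qed simp
  hence "X \<longlonglongrightarrow> L" by (rule iffD2[OF tendsto_dist_iff])
  thus "convergent X" by (auto simp: convergent_def)
qed


instance padic :: (prime_card) perfect_space
proof
  fix x :: "'a padic"
  let ?p = "CARD('a)"
  have p: "prime ?p" by (rule prime_card)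
  have p1: "real ?p > 1" using p prime_gt_1_nat by auto
  have abs_p: "padic_abs ?p (of_nat ?p) = inverse (real ?p)"
    using padic_abs_fraction[OF p, of "int ?p" 1] p
    by (simp add: power_int_minus prime_gt_0_nat multiplicity_self[of "int ?p"])
  have norm_pow: "padic_norm (of_rat (of_nat ?p ^ n) :: 'a padic) = inverse (real ?p) ^ n" for n
    unfolding padic_norm_of_rat by (induction n) (simp_all add: padic_abs_mult[OF p] padic_abs_1[OF p] abs_p)
  show "\<not> open {x}"
  proof
    assume "open {x}"
    then obtain e where e: "e > 0" "\<And>y. dist y x < e \<Longrightarrow> y = x"
      unfolding open_dist by blast
    obtain n where n: "inverse (real ?p) ^ n < e"
      using real_arch_pow_inv[OF e(1), of "inverse (real ?p)"] p1 by (auto simp: inverse_less_1_iff)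
    have "x + of_rat (of_nat ?p ^ n) = x"
      by (rule e(2)) (use n in \<open>simp add: dist_padic_def norm_pow del: of_rat_power\<close>)
    thus False using p by auto
  qed
qed


section \<open>Derivatives and the dynamical system\<close>

text \<open>
  The library derivatives require a real normed field, which \<open>\<rat>\<^sub>p\<close> is not; hence the
  usual difference quotients over the metric topology.
\<close>

definition padic_has_deriv ::
    "('p::prime_card padic \<Rightarrow> 'p padic) \<Rightarrow> 'p padic \<Rightarrow> 'p padic \<Rightarrow> bool" where
  "padic_has_deriv g D x \<longleftrightarrow> ((\<lambda>y. (g y - g x) / (y - x)) \<longlongrightarrow> D) (at x)"

lemma padic_has_deriv_unique:
  "padic_has_deriv g D x \<Longrightarrow> padic_has_deriv g E x \<Longrightarrow> D = E"
  unfolding padic_has_deriv_def by (rule tendsto_unique[OF at_neq_bot])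

definition padic_deriv ::
    "('p::prime_card padic \<Rightarrow> 'p padic) \<Rightarrow> 'p padic \<Rightarrow> 'p padic" where
  "padic_deriv g x = (THE D. padic_has_deriv g D x)"

definition padic_sphere :: "real \<Rightarrow> 'p::prime_card padic set" where
  "padic_sphere r = {x. padic_norm x = r}"

text \<open>
  The map is only meaningful off its pole \<open>- b / a\<close>, where the total division yields \<open>0\<close>.
  The spheres with radius in \<open>radii\<close> below are open and do not contain the pole, so this value
  affects neither the orbits inside such a sphere nor the derivatives of the iterates there.
\<close>

definition ratfun :: "'p::prime_card padic \<Rightarrow> 'p padic \<Rightarrow> 'p padic \<Rightarrow> 'p padic" where
  "ratfun a b x = (x ^ 3 + a * x ^ 2 + b * x) / (a * x + b)"

text \<open>
  With \<open>\<alpha> \<le> \<beta>\<close> the absolute values of the roots of \<open>x\<^sup>2 + a x + b\<close> and \<open>\<delta>\<close> that of \<open>a\<close>,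
  one of the first two cases always applies; the last one only makes the function total.
\<close>

definition radii :: "real \<Rightarrow> real \<Rightarrow> real \<Rightarrow> real set" where
  "radii \<alpha> \<beta> \<delta> =
     (if \<delta> \<le> \<alpha> \<and> \<alpha> = \<beta> then {0<..<\<alpha>}
      else if \<alpha> < \<beta> \<and> \<beta> = \<delta> then {0<..<\<beta>} - {\<alpha>}
      else {})"

text \<open>
  A closed orbit \<open>y 0 \<rightarrow> y 1 \<rightarrow> \<dots> \<rightarrow> y (k - 1) \<rightarrow> y 0\<close>; \<open>k\<close> need not be the least period.
\<close>

definition periodic_orbit :: "('a \<Rightarrow> 'a) \<Rightarrow> 'a set \<Rightarrow> nat \<Rightarrow> (nat \<Rightarrow> 'a) \<Rightarrow> bool" where
  "periodic_orbit g S k y \<longleftrightarrow> (\<forall>i<k. y i \<in> S \<and> g (y i) = y (Suc i mod k))"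

end

theory Submission
  imports Defs
begin

text \<open>
  Write \<open>l = a x + b\<close>. Since \<open>f(x) = x + x\<^sup>3 / l\<close>, we have
  \<open>f'(x) = 1 + x\<^sup>2 (2 a x + 3 b) / l\<^sup>2\<close>. For \<open>r \<in> A\<close> the radius avoids \<open>|a x| = |b|\<close>, so on the sphere
  \<open>|l| = max(|a| r, |b|)\<close>, which dominates \<open>|2 a x + 3 b|\<close> and exceeds \<open>r\<^sup>2\<close>. Hence \<open>|f' - 1| < 1\<close> and
  \<open>|f'| = 1\<close> at every point of the sphere, and the chain rule along the orbit gives the claim.
\<close>

section \<open>Ultrametric arithmetic of the norm\<close>

lemma padic_norm_0 [simp]: "padic_norm (0 :: 'p::prime_card padic) = 0"
  by (subst padic_norm_eq_0_iff) (rule refl)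

lemma padic_norm_1 [simp]: "padic_norm (1 :: 'p::prime_card padic) = 1"
  using padic_norm_mult[of "1 :: 'p padic" 1] by simp

lemma padic_norm_of_nat_le_1: "padic_norm (of_nat n :: 'p::prime_card padic) \<le> 1"
proof (induction n)
  case (Suc n)
  then show ?case using padic_norm_add_le[of 1 "of_nat n :: 'p padic"] by simp
qed simp

lemma padic_norm_numeral_le_1: "padic_norm (numeral n :: 'p::prime_card padic) \<le> 1"
  using padic_norm_of_nat_le_1[of "numeral n"] by simp

lemma padic_norm_power: "padic_norm (x ^ n) = padic_norm (x :: 'p::prime_card padic) ^ n"
  by (induction n) (simp_all add: padic_norm_mult)

lemma padic_norm_inverse: "padic_norm (inverse x) = inverse (padic_norm (x :: 'p::prime_card padic))"
proof (cases "x = 0")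
  case False
  then have "padic_norm x * padic_norm (inverse x) = 1"
    by (simp flip: padic_norm_mult)
  then show ?thesis by (rule inverse_unique[symmetric])
qed simp

lemma padic_norm_divide: "padic_norm (x / y) = padic_norm x / padic_norm (y :: 'p::prime_card padic)"
  by (simp add: divide_inverse padic_norm_mult padic_norm_inverse)

text \<open>Writing \<open>x = (x + y) + (- y)\<close> gives |x| \<le> max(|x + y|, |y|), and |y| <
  |x| then forces |x| \<le> |x + y|.\<close>

lemma padic_norm_add_eq_left:
  fixes x y :: "'p::prime_card padic"
  assumes "padic_norm y < padic_norm x"
  shows "padic_norm (x + y) = padic_norm x"
  using padic_norm_add_le[of x y] padic_norm_add_le[of "x + y" "- y"] assms by auto

lemma padic_norm_add_eq_max:
  fixes x y :: "'p::prime_card padic"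
  assumes "padic_norm x \<noteq> padic_norm y"
  shows "padic_norm (x + y) = max (padic_norm x) (padic_norm y)"
  using padic_norm_add_eq_left[of x y] padic_norm_add_eq_left[of y x] assms
  by (auto simp: max_def add.commute)

section \<open>Continuity of the field operations\<close>

lemma tendsto_padic_iff:
  fixes g :: "'b \<Rightarrow> 'p::prime_card padic"
  shows "(g \<longlongrightarrow> L) F \<longleftrightarrow> ((\<lambda>z. padic_norm (g z - L)) \<longlongrightarrow> 0) F"
  by (simp add: tendsto_dist_iff[of g] dist_padic_def)

lemma tendsto_padic_norm:
  fixes g :: "'b \<Rightarrow> 'p::prime_card padic"
  assumes "(g \<longlongrightarrow> L) F"
  shows "((\<lambda>z. padic_norm (g z)) \<longlongrightarrow> padic_norm L) F"
  using tendsto_dist[OF assms tendsto_const[of 0]] by (simp add: dist_padic_def)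

text \<open>Together with the multiplicative instance that follows, this opens the general limit
  rules for sums, differences and products to functions with \<open>p\<close>-adic values.\<close>

instance padic :: (prime_card) topological_ab_group_add
proof
  fix a b :: "'a padic"
  have fst: "(fst \<longlongrightarrow> a) (nhds a \<times>\<^sub>F nhds b)" and snd: "(snd \<longlongrightarrow> b) (nhds a \<times>\<^sub>F nhds b)"
    by (rule filterlim_fst filterlim_snd)+
  show "((\<lambda>z. fst z + snd z) \<longlongrightarrow> a + b) (nhds a \<times>\<^sub>F nhds b)"
    unfolding tendsto_padic_iff
  proof (rule Lim_null_comparison)
    have "padic_norm (x + y - (a + b)) \<le> max (padic_norm (x - a)) (padic_norm (y - b))" for x y
      using padic_norm_add_le[of "x - a" "y - b"] by (simp add: algebra_simps)
    then show "\<forall>\<^sub>F z in nhds a \<times>\<^sub>F nhds b. norm (padic_norm (fst z + snd z - (a + b)))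
        \<le> max (padic_norm (fst z - a)) (padic_norm (snd z - b))"
      by simp
    show "((\<lambda>z. max (padic_norm (fst z - a)) (padic_norm (snd z - b))) \<longlongrightarrow> 0)
        (nhds a \<times>\<^sub>F nhds b)"
      using tendsto_max[OF fst[unfolded tendsto_padic_iff] snd[unfolded tendsto_padic_iff]] by simp
  qed
next
  fix a :: "'a padic"
  have "padic_norm (a - x) = padic_norm (x - a)" for x
    using padic_norm_minus[of "x - a"] by simp
  then show "(uminus \<longlongrightarrow> - a) (nhds a)"
    using filterlim_ident[of "nhds a"] by (simp add: tendsto_padic_iff)
qed

instance padic :: (prime_card) topological_comm_monoid_mult
proof
  fix a b :: "'a padic"
  have fst: "(fst \<longlongrightarrow> a) (nhds a \<times>\<^sub>F nhds b)" and snd: "(snd \<longlongrightarrow> b) (nhds a \<times>\<^sub>F nhds b)"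
    by (rule filterlim_fst filterlim_snd)+
  let ?u = "\<lambda>z. padic_norm (fst z - a) * padic_norm (snd z)"
  let ?v = "\<lambda>z. padic_norm a * padic_norm (snd z - b)"
  show "((\<lambda>z. fst z * snd z) \<longlongrightarrow> a * b) (nhds a \<times>\<^sub>F nhds b)"
    unfolding tendsto_padic_iff
  proof (rule Lim_null_comparison)
    \<comment> \<open>The splitting is
      \<open>x * y - a * b = (x - a) * y + a * (y - b)\<close>.\<close>
    have "padic_norm (x * y - a * b) \<le> max (padic_norm (x - a) * padic_norm y) (padic_norm a * padic_norm (y - b))"
      for x y
      using padic_norm_add_le[of "(x - a) * y" "a * (y - b)"]
      by (simp add: algebra_simps flip: padic_norm_mult)
    then show "\<forall>\<^sub>F z in nhds a \<times>\<^sub>F nhds b. norm (padic_norm (fst z * snd z - a * b)) \<le> max (?u z) (?v z)"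
      by simp
    show "((\<lambda>z. max (?u z) (?v z)) \<longlongrightarrow> 0) (nhds a \<times>\<^sub>F nhds b)"
      using tendsto_max[OF tendsto_mult[OF fst[unfolded tendsto_padic_iff] tendsto_padic_norm[OF snd]]
          tendsto_mult[OF tendsto_const[of "padic_norm a"] snd[unfolded tendsto_padic_iff]]] by simp
  qed
qed

text \<open>As soon as \<open>g z\<close> is nonzero, |1/g(z) - 1/L| = |g(z) - L| / (|g(z)| |L|),
  and this denominator tends to the nonzero number |L| |L|.\<close>

lemma tendsto_padic_inverse:
  fixes g :: "'b \<Rightarrow> 'p::prime_card padic"
  assumes g: "(g \<longlongrightarrow> L) F" and L: "L \<noteq> 0"
  shows "((\<lambda>z. inverse (g z)) \<longlongrightarrow> inverse L) F"
  unfolding tendsto_padic_iff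
proof (rule Lim_transform_eventually)
  show "((\<lambda>z. padic_norm (g z - L) / (padic_norm (g z) * padic_norm L)) \<longlongrightarrow> 0) F"
    using tendsto_divide[OF g[unfolded tendsto_padic_iff]
        tendsto_mult_right[OF tendsto_padic_norm[OF g], of "padic_norm L"]] L by simp
  show "\<forall>\<^sub>F z in F. padic_norm (g z - L) / (padic_norm (g z) * padic_norm L)
      = padic_norm (inverse (g z) - inverse L)"
    using tendsto_imp_eventually_ne[OF g L]
  proof eventually_elim
    case (elim z)
    have "inverse (g z) - inverse L = - (g z - L) / (g z * L)"
      using elim L by (simp add: field_simps)
    then show ?case by (simp only: padic_norm_divide padic_norm_mult padic_norm_minus)
  qed
qed

section \<open>Calculus with difference quotients\<close>

lemma padic_has_deriv_isCont:
  assumes "padic_has_deriv g D x"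
  shows "isCont g x"
proof -
  have "((\<lambda>y. (g y - g x) / (y - x) * (y - x) + g x) \<longlongrightarrow> D * (x - x) + g x) (at x)"
    using assms unfolding padic_has_deriv_def by (intro tendsto_intros)
  then have "(g \<longlongrightarrow> D * (x - x) + g x) (at x)"
    by (rule Lim_transform_eventually) (auto simp: eventually_at_filter)
  then show ?thesis by (simp add: isCont_def)
qed

lemma padic_has_deriv_comp:
  assumes g: "padic_has_deriv g D x" and h: "padic_has_deriv h E (g x)"
  shows "padic_has_deriv (h \<circ> g) (E * D) x"
proof -
  \<comment> \<open>Filling the gap of the quotient with \<open>E\<close> makes
    \<open>\<phi>\<close> continuous at \<open>g x\<close>. Then
    \<open>h (g y) - h (g x) = \<phi> (g y) * (g y - g x)\<close> holds also for those
    \<open>y\<close> with \<open>g y = g x\<close>, where the quotient itself would divide by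
    zero.\<close>
  define \<phi> where "\<phi> z = (if z = g x then E else (h z - h (g x)) / (z - g x))" for z
  have "(\<phi> \<longlongrightarrow> E) (at (g x))"
    using h unfolding padic_has_deriv_def
    by (rule Lim_transform_eventually) (auto simp: eventually_at_filter \<phi>_def)
  then have "isCont \<phi> (g x)" by (simp add: isCont_def \<phi>_def)
  then have "((\<lambda>y. \<phi> (g y)) \<longlongrightarrow> \<phi> (g x)) (at x)"
    using padic_has_deriv_isCont[OF g, THEN isContD] by (rule isCont_tendsto_compose)
  then have "((\<lambda>y. \<phi> (g y) * ((g y - g x) / (y - x))) \<longlongrightarrow> E * D) (at x)"
    using g unfolding padic_has_deriv_def by (intro tendsto_mult) (auto simp: \<phi>_def)
  then show ?thesis
    unfolding padic_has_deriv_def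
    by (rule Lim_transform_eventually) (auto simp: \<phi>_def)
qed

lemma padic_has_deriv_funpow:
  assumes "\<And>j. j < k \<Longrightarrow> padic_has_deriv g (D j) ((g ^^ j) x)"
  shows "padic_has_deriv (g ^^ k) (\<Prod>j<k. D j) x"
  using assms
proof (induction k)
  case 0
  \<comment> \<open>The quotient of the identity is 1 only off \<open>x\<close>; at \<open>x\<close>
    itself total division gives 0, which the punctured limit ignores.\<close>
  have "((\<lambda>y. 1) \<longlongrightarrow> 1) (at x)" by (rule tendsto_const)
  then have "((\<lambda>y. (y - x) / (y - x)) \<longlongrightarrow> 1) (at x)"
    by (rule Lim_transform_eventually) (auto simp: eventually_at_filter)
  then show ?case by (simp add: padic_has_deriv_def)
next
  case (Suc k)
  then show ?case
    using padic_has_deriv_comp[of "g ^^ k" "\<Prod>j<k. D j" x g "D k"]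
    by (simp add: mult.commute comp_def)
qed

lemma padic_deriv_eqI: "padic_has_deriv g D x \<Longrightarrow> padic_deriv g x = D"
  unfolding padic_deriv_def by (blast intro: padic_has_deriv_unique)

lemma padic_norm_prod: "padic_norm (\<Prod>j\<in>J. g j) = (\<Prod>j\<in>J. padic_norm (g j :: 'p::prime_card padic))"
  by (induction J rule: infinite_finite_induct) (simp_all add: padic_norm_mult)

section \<open>The derivative of the map and its norm\<close>

lemma ratfun_has_deriv:
  fixes a b x :: "'p::prime_card padic"
  assumes l: "a * x + b \<noteq> 0"
  shows "padic_has_deriv (ratfun a b) (1 + x\<^sup>2 * (2 * a * x + 3 * b) / (a * x + b)\<^sup>2) x"
proof -
  let ?l = "\<lambda>y. a * y + b"
  \<comment> \<open>\<open>Q\<close> is the difference quotient with the factor \<open>y - x\<close>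
    cancelled, so the derivative is simply \<open>Q x\<close>. It comes from f(z) = z + z^3/l(z) and
    y^3 l(x) - x^3 l(y) = (y - x) ((y^2 + x y + x^2) l(x) - a x^3).\<close>
  define Q where "Q y = 1 + ((y * y + x * y + x * x) * ?l x - a * (x * x * x)) * inverse (?l x) * inverse (?l y)" for y
  have lim: "(?l \<longlongrightarrow> ?l x) (at x)"
    by (intro tendsto_intros)
  have tendsto: "(Q \<longlongrightarrow> Q x) (at x)"
    unfolding Q_def
    by (intro tendsto_intros tendsto_padic_inverse[OF lim l])
  have quotient: "\<forall>\<^sub>F y in at x. Q y = (ratfun a b y - ratfun a b x) / (y - x)"
    using tendsto_imp_eventually_ne[OF lim l] eventually_neq_at_within[of x]
  proof eventually_elim
    case (elim y)
    have *: "ratfun a b z = z + z ^ 3 / ?l z" if "?l z \<noteq> 0" for z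
      using that by (simp add: ratfun_def field_simps power2_eq_square power3_eq_cube)
    have "Q y * (y - x) = ratfun a b y - ratfun a b x"
    proof -
      have "((y * y + x * y + x * x) * ?l x - a * (x * x * x)) * (y - x) = y ^ 3 * ?l x - x ^ 3 * ?l y"
        by (simp add: algebra_simps power3_eq_cube)
      moreover have "Q y * (y - x) = y - x + ((y * y + x * y + x * x) * ?l x - a * (x * x * x)) * (y - x)
          * (inverse (?l x) * inverse (?l y))"
        by (simp only: Q_def distrib_left distrib_right mult_1_left mult_1_right mult_ac)
      ultimately have "Q y * (y - x) = y - x + (y ^ 3 * ?l x - x ^ 3 * ?l y) * (inverse (?l x) * inverse (?l y))"
        by (simp only:)
      also have "\<dots> = y - x + (y ^ 3 / ?l y - x ^ 3 / ?l x)"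
        unfolding diff_frac_eq[OF elim(1) l] by (simp add: divide_inverse mult.commute)
      finally show ?thesis by (simp add: *[OF elim(1)] *[OF l])
    qed
    then show ?case using elim by (simp add: field_simps)
  qed
  have "(x * x + x * x + x * x) * ?l x - a * (x * x * x) = x\<^sup>2 * (2 * a * x + 3 * b)"
    by (simp add: algebra_simps power2_eq_square)
  then have "Q x = 1 + x\<^sup>2 * (2 * a * x + 3 * b) / (?l x)\<^sup>2"
    by (simp only: Q_def divide_inverse power2_eq_square[of "?l x"] inverse_mult_distrib mult.assoc)
  then show ?thesis
    using Lim_transform_eventually[OF tendsto quotient] by (simp only: padic_has_deriv_def)
qed

lemma ratfun_has_unit_deriv:
  fixes a b x :: "'p::prime_card padic"
  assumes ne: "padic_norm (a * x) \<noteq> padic_norm b"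
    and less: "(padic_norm x)\<^sup>2 < max (padic_norm (a * x)) (padic_norm b)"
  shows "\<exists>D. padic_has_deriv (ratfun a b) D x \<and> padic_norm D = 1"
proof -
  define M where "M = max (padic_norm (a * x)) (padic_norm b)"
  have l: "padic_norm (a * x + b) = M"
    unfolding M_def by (rule padic_norm_add_eq_max[OF ne])
  have M: "M > 0"
    using less zero_le_power2[of "padic_norm x"] unfolding M_def by linarith
  \<comment> \<open>Integers have norm at most 1, so the coefficients 2 and 3 never enlarge a term;
    the primes 2 and 3 need no separate treatment.\<close>
  have numeral_le: "padic_norm (numeral n * u) \<le> padic_norm u" for n and u :: "'p padic"
    using mult_right_mono[OF padic_norm_numeral_le_1[of n, where 'p='p] padic_norm_nonneg[of u]]
    by (simp add: padic_norm_mult)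
  have "padic_norm (2 * a * x + 3 * b) \<le> M"
    using padic_norm_add_le[of "2 * (a * x)" "3 * b"] numeral_le[of _ "a * x"] numeral_le[of _ b]
    unfolding M_def by (simp add: mult.assoc) (meson le_max_iff_disj order_trans)
  then have "padic_norm (x\<^sup>2 * (2 * a * x + 3 * b)) \<le> (padic_norm x)\<^sup>2 * M"
    by (simp add: padic_norm_mult padic_norm_power mult_left_mono)
  also have "\<dots> < M\<^sup>2"
    using less M by (simp add: power2_eq_square flip: M_def)
  finally have "padic_norm (x\<^sup>2 * (2 * a * x + 3 * b) / (a * x + b)\<^sup>2) < 1"
    using M by (simp add: padic_norm_divide padic_norm_power l)
  then have "padic_norm (1 + x\<^sup>2 * (2 * a * x + 3 * b) / (a * x + b)\<^sup>2) = 1"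
    using padic_norm_add_eq_left[of _ "1 :: 'p padic"] by simp
  moreover have "a * x + b \<noteq> 0" using l M padic_norm_eq_0_iff[of "a * x + b"] by simp
  ultimately show ?thesis using ratfun_has_deriv by blast
qed

section \<open>Periodic orbits and the conclusion\<close>

lemma periodic_orbit_funpow_mem:
  assumes orbit: "periodic_orbit g S k y" and i: "i < k"
  shows "(g ^^ j) (y i) \<in> S"
proof -
  \<comment> \<open>The iterates run through the orbit cyclically, so each point where the chain
    rule needs a derivative lies in \<open>S\<close>.\<close>
  have "(g ^^ j) (y i) = y ((i + j) mod k)"
  proof (induction j)
    case (Suc j)
    have "g (y ((i + j) mod k)) = y (Suc ((i + j) mod k) mod k)"
      using orbit i by (simp add: periodic_orbit_def)
    then show ?case using Suc by (simp add: mod_Suc_eq)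
  qed (use i in simp)
  then show ?thesis using orbit i by (simp add: periodic_orbit_def)
qed

text \<open>Differentiability is part of the conclusion because \<open>padic_deriv\<close> is a
  definite description, whose value is meaningful only if a derivative exists. The disjunction on
  \<open>x1\<close> and \<open>x2\<close> leaves the labelling of the roots free.\<close>

theorem corollary3:
  fixes a b s x1 x2 :: "'p::prime_card padic"
    and \<alpha> \<beta> \<delta> r :: real
    and k :: nat
    and y :: "nat \<Rightarrow> 'p padic"
  assumes "a * b \<noteq> 0"
    and "s ^ 2 = a ^ 2 - 4 * b"
    and "x1 = (- a + s) / 2 \<and> x2 = (- a - s) / 2 \<or> x1 = (- a - s) / 2 \<and> x2 = (- a + s) / 2"
    and "\<alpha> = padic_norm x1" and "\<beta> = padic_norm x2" and "\<alpha> \<le> \<beta>"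
    and "\<delta> = padic_norm a"
    and "r \<in> radii \<alpha> \<beta> \<delta>"
    and "k \<ge> 1"
    and "periodic_orbit (ratfun a b) (padic_sphere r) k y"
  shows "\<forall>i<k. (\<exists>D. padic_has_deriv (ratfun a b ^^ k) D (y i)) \<and>
    padic_norm (padic_deriv (ratfun a b ^^ k) (y i)) = 1"
proof (intro allI impI)
  fix i assume i: "i < k"
  \<comment> \<open>Vieta's formula turns the radii \<alpha> and \<beta> into information about
    |b|.\<close>
  have "x1 * x2 = (a\<^sup>2 - s\<^sup>2) / 4"
    using assms(3) by (elim disjE conjE; simp only:) (simp_all add: field_simps power2_eq_square)
  then have b: "x1 * x2 = b"
    using assms(2) by simp
  have norm_b: "padic_norm b = \<alpha> * \<beta>"
    using assms(4,5) by (simp add: padic_norm_mult flip: b)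
  have \<alpha>0: "\<alpha> > 0"
    using assms(1,4) b padic_norm_nonneg[of x1] by (auto simp: less_le)
  \<comment> \<open>These are the two hypotheses of \<open>ratfun_has_unit_deriv\<close>, with |a x|
    = \<delta> r and |b| = \<alpha> \<beta>.\<close>
  have "\<delta> * r \<noteq> \<alpha> * \<beta> \<and> r\<^sup>2 < max (\<delta> * r) (\<alpha> * \<beta>)"
  proof (cases "\<delta> \<le> \<alpha> \<and> \<alpha> = \<beta>")
    case True
    then have r: "0 < r" "r < \<alpha>" using assms(8) by (auto simp: radii_def)
    \<comment> \<open>Here |b| = \<alpha> \<alpha> is the dominating term.\<close>
    have "\<delta> * r \<le> \<alpha> * r" using True r by simp
    also have "\<dots> < \<alpha> * \<alpha>" using r \<alpha>0 by simp
    finally have "\<delta> * r < \<alpha> * \<alpha>" .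
    moreover have "r\<^sup>2 < \<alpha> * \<alpha>"
      using r by (simp add: power2_eq_square mult_strict_mono)
    ultimately show ?thesis using True by (simp add: max_def)
  next
    case False
    \<comment> \<open>The empty default case of \<open>radii\<close> is ruled out by
      \<open>r\<close> being a member. With \<delta> = \<beta>, the condition r \<noteq> \<alpha>
      separates \<beta> r from \<alpha> \<beta>, and r < \<beta> gives r r < \<delta> r.\<close>
    then have r: "0 < r" "r < \<beta>" "r \<noteq> \<alpha>" "\<delta> = \<beta>"
      using assms(8) by (auto simp: radii_def split: if_splits)
    then show ?thesis by (auto simp: power2_eq_square less_max_iff_disj)
  qed
  then have unit: "\<exists>D. padic_has_deriv (ratfun a b) D x \<and> padic_norm D = 1" if "x \<in> padic_sphere r" for x
    using that assms(7) norm_b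
    by (intro ratfun_has_unit_deriv) (simp_all add: padic_sphere_def padic_norm_mult)
  obtain D where D: "padic_has_deriv (ratfun a b) (D j) ((ratfun a b ^^ j) (y i))" "padic_norm (D j) = 1" for j
    using unit[OF periodic_orbit_funpow_mem[OF assms(10) i]] by metis
  have "padic_has_deriv (ratfun a b ^^ k) (\<Prod>j<k. D j) (y i)"
    by (rule padic_has_deriv_funpow) (rule D)
  moreover have "padic_norm (\<Prod>j<k. D j) = 1"
    by (simp add: padic_norm_prod D)
  ultimately show "(\<exists>D. padic_has_deriv (ratfun a b ^^ k) D (y i)) \<and>
      padic_norm (padic_deriv (ratfun a b ^^ k) (y i)) = 1"
    using padic_deriv_eqI by metis
qed

end
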